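(* For all integers $n\ge 1$, $$N_n(x)=\frac{1}{n!}\sum_{w\in\mathfrak{S}_n}B_w(x)\,E_{\ell_w}(x).$$
   Context: $\mathfrak{S}_n$ is the symmetric group on $\{1,\ldots,n\}$. The Narayana polynomial is $N_n(x)=\sum_{k=0}^{n-1}\frac1n\binom nk\binom n{k+1}x^k$. The Eulerian polynomial is $E_n(x)=\sum_{w\in\mathfrak{S}_n}x^{\operatorname{des}(w)}$, where $\operatorname{des}(w)=|\{i: w_i>w_{i+1}\}|$. The type B Narayana polynomial is $B_n(x)=\sum_{k=0}^{n-1}\binom{n-1}{k}^2x^k$. For $w\in\mathfrak{S}_n$ with cycle type $(\lambda_1,\ldots,\lambda_\ell)$ (fixed points counted as cycles), $\ell_w=\ell$ is the number of cycles of $w$ and $B_w(x)=B_{\lambda_1}(x)\cdots B_{\lambda_\ell}(x)$. *)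

theory Defs
  imports
    "HOL-Combinatorics.Orbits"
    "HOL-Computational_Algebra.Polynomial"
    "HOL-Library.Multiset"
begin

definition narayana_poly :: "nat \<Rightarrow> rat poly" where
  "narayana_poly n =
     (\<Sum>k<n. monom (1 / of_nat n * of_nat (n choose k) * of_nat (n choose (k + 1))) k)"

definition narayana_B_poly :: "nat \<Rightarrow> rat poly" where
  "narayana_B_poly n = (\<Sum>k<n. monom (of_nat (((n - 1) choose k)\<^sup>2)) k)"

definition des :: "nat \<Rightarrow> (nat \<Rightarrow> nat) \<Rightarrow> nat" where
  "des n w = card {i. 1 \<le> i \<and> i < n \<and> w i > w (i + 1)}"

definition eulerian_poly :: "nat \<Rightarrow> rat poly" where
  "eulerian_poly n = (\<Sum>w\<in>{w. w permutes {1..n}}. monom 1 (des n w))"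

text \<open>The cycles are identified with their supports, the orbits of \<open>w\<close> on \<open>{1..n}\<close>;
  a fixed point contributes a singleton orbit, hence a part 1.\<close>

definition cycle_type :: "nat \<Rightarrow> (nat \<Rightarrow> nat) \<Rightarrow> nat multiset" where
  "cycle_type n w = image_mset card (mset_set (orbit w ` {1..n}))"

definition num_cycles :: "nat \<Rightarrow> (nat \<Rightarrow> nat) \<Rightarrow> nat" where
  "num_cycles n w = size (cycle_type n w)"

definition narayana_B_perm :: "nat \<Rightarrow> (nat \<Rightarrow> nat) \<Rightarrow> rat poly" where
  "narayana_B_perm n w = prod_mset (image_mset narayana_B_poly (cycle_type n w))"

end

theory Submission
  imports Defs "HOL-Computational_Algebra.Formal_Power_Series"
begin

text \<open>Put \<open>N = \<Sum>n\<ge>1. N\<^sub>n z^n\<close> and \<open>L = \<Sum>n\<ge>1. B\<^sub>n z^n / n\<close>. The coefficient recurrences yield the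
  quadratic equation \<open>N = z (1 + N) (1 + x N)\<close> and, by differentiation,
  \<open>N' = (1 + N) (1 + x N) L'\<close>. With \<open>a = 1 + N\<close> and \<open>b = 1 + x N\<close> the derivation \<open>d/dL\<close>
  therefore acts by \<open>a \<mapsto> a b\<close>, \<open>b \<mapsto> x a b\<close>, and its \<open>m\<close>-th iterate sends \<open>a\<close> to a homogenised Eulerian polynomial
  in \<open>a, b\<close>, with value \<open>E\<^sub>m(x)\<close> at \<open>z = 0\<close>. Faa di Bruno's formula, written as a sum over
  permutations, expresses the \<open>n\<close>-th \<open>z\<close>-derivative of \<open>a\<close> at \<open>0\<close>, which is \<open>n! N\<^sub>n\<close>, through
  the \<open>E\<^sub>m\<close> and the derivatives of \<open>L\<close>, that is, the \<open>B\<^sub>m\<close>.\<close>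

subsection \<open>Inserting an element into the cycles of a permutation\<close>

text \<open>Since \<open>q\<close> fixes \<open>a\<close>, the composition sends the
  \<open>q\<close>-preimage of \<open>b\<close> to \<open>a\<close>, and \<open>a\<close> to
  \<open>b\<close>. So \<open>a\<close> is spliced into the cycle of \<open>b\<close> just before
  \<open>b\<close>, and all other arrows stay.\<close>

lemma orbit_transpose_comp:
  assumes q: "q permutes S" and S: "finite S" and a: "a \<notin> S" and b: "b \<in> S" and x: "x \<in> S"
  shows "orbit (transpose a b \<circ> q) x = (if b \<in> orbit q x then insert a (orbit q x) else orbit q x)"
    (is "orbit ?p x = ?R")
proof -
  define p where "p = transpose a b \<circ> q"
  have sub: "orbit q x \<subseteq> S"
    using permutes_orbit_subset[OF q x] .
  have pa: "p a = b"
    using permutes_not_in[OF q a] by (simp add: p_def)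
  have pb: "p y = a" if "q y = b" for y
    using that by (simp add: p_def)
  have pn: "p y = q y" if "q y \<noteq> b" "q y \<in> S" for y
    using that a by (auto simp: p_def transpose_def)
  have qS: "q y \<in> S" if "y \<in> S" for y
    using that permutes_in_image[OF q] by simp
  have le: "y \<in> ?R" if "y \<in> orbit p x" for y
    using that
  proof induction
    case base
    show ?case
      using pb[of x] pn[of x] qS[OF x] orbit.base[of q x] by (cases "q x = b") auto
  next
    case (step y)
    show ?case
    proof (cases "y = a")
      case True
      then show ?thesis using step.IH sub a pa by (auto split: if_splits)
    next
      case False
      then have y: "y \<in> orbit q x" using step.IH by (auto split: if_splits)
      then show ?thesis
        using pb[of y] pn[of y] qS[of y] orbit.step[OF y] sub by (cases "q y = b") auto
    qed
  qed
  have ge: "y \<in> orbit p x" if "y \<in> orbit q x" for y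
    using that
  proof induction
    case base
    show ?case
      using pb[of x] pn[of x] qS[OF x] pa orbit.base[of p x] orbit.step[of a p x]
      by (cases "q x = b") auto
  next
    case (step y)
    then show ?case
      using pb[of y] pn[of y] qS[of y] pa orbit.step[of y p x] orbit.step[of a p x] sub
      by (cases "q y = b") auto
  qed
  have "a \<in> orbit p x" if "b \<in> orbit q x"
  proof -
    obtain y where y: "b = q y" "y = x \<or> y \<in> orbit q x"
      using \<open>b \<in> orbit q x\<close> by cases auto
    then show ?thesis
      using pb[of y] orbit.base[of p x] orbit.step[of y p x] ge[of y] by metis
  qed
  then have "y \<in> orbit p x \<longleftrightarrow> y \<in> ?R" for y
    using le[of y] ge[of y] by (auto split: if_splits)
  then show ?thesis
    unfolding p_def by blast
qed

lemma orbit_eq_of_mem: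
  assumes "q permutes S" "finite S" "y \<in> orbit q x"
  shows "orbit q y = orbit q x"
  using orbit_cyclic_eq3[OF cyclic_on_orbit[OF assms(1,2)] assms(3)] .

lemma self_in_orbit:
  assumes "q permutes S" "finite S"
  shows "x \<in> orbit q x"
  using assms by (intro permutation_self_in_orbit) (auto simp: permutation_permutes)

lemma orbits_insert_fixed:
  assumes q: "q permutes S" and a: "a \<notin> S"
  shows "orbit q ` insert a S = insert {a} (orbit q ` S)" and "{a} \<notin> orbit q ` S"
proof -
  have "orbit q a = {a}"
    using permutes_not_in[OF q a] by (simp add: orbit_eq_singleton_iff)
  then show "orbit q ` insert a S = insert {a} (orbit q ` S)" by simp
  show "{a} \<notin> orbit q ` S"
    using permutes_orbit_subset[OF q] a by blast
qed

text \<open>Splicing enlarges one orbit and keeps the rest. The second claim lets the enlarged orbit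
  be split off as a separate factor in products over orbits.\<close>

lemma orbits_transpose_comp:
  assumes q: "q permutes S" and S: "finite S" and a: "a \<notin> S" and b: "b \<in> S"
  shows "orbit (transpose a b \<circ> q) ` insert a S
    = insert (insert a (orbit q b)) (orbit q ` S - {orbit q b})" (is "orbit ?p ` _ = ?R")
    and "insert a (orbit q b) \<notin> orbit q ` S"
proof -
  have p: "?p permutes insert a S"
    by (rule permutes_compose[OF permutes_subset[OF q] permutes_swap_id]) (use b in auto)
  have eq: "orbit ?p x = (if orbit q x = orbit q b then insert a (orbit q b) else orbit q x)"
    if "x \<in> S" for x
  proof (cases "b \<in> orbit q x")
    case True
    then have "orbit q b = orbit q x" by (rule orbit_eq_of_mem[OF q S])
    with True show ?thesis by (simp only: orbit_transpose_comp[OF q S a b that] if_True simp_thms)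
  next
    case False
    then have "orbit q x \<noteq> orbit q b"
      using self_in_orbit[OF q S, of b] by auto
    with False show ?thesis by (simp only: orbit_transpose_comp[OF q S a b that] if_False)
  qed
  have "?p a = b"
    using permutes_not_in[OF q a] by simp
  then have "b \<in> orbit ?p a"
    using orbit.base[of ?p a] by (simp only:)
  \<comment> \<open>The new point shares its orbit with \<open>b\<close>, so it contributes no orbit
    of its own.\<close>
  then have "orbit ?p b = orbit ?p a"
    using S by (intro orbit_eq_of_mem[OF p]) auto
  then have "orbit ?p ` insert a S = orbit ?p ` S"
    using b by (simp only: image_insert) blast
  also have "\<dots> = (\<lambda>x. if orbit q x = orbit q b then insert a (orbit q b) else orbit q x) ` S"
    using eq by (rule image_cong[OF refl])
  also have "\<dots> = ?R"
    using b by auto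
  finally show "orbit ?p ` insert a S = ?R" .
  show "insert a (orbit q b) \<notin> orbit q ` S"
    using permutes_orbit_subset[OF q] a by blast
qed

text \<open>A cycle offers as many splicing places as it has elements. This weight becomes the
  factor \<open>of_nat m\<close> in the derivative of \<open>b m\<close>.\<close>

lemma sum_over_orbits:
  fixes h :: "'a set \<Rightarrow> 'b :: comm_semiring_1"
  assumes q: "q permutes S" and S: "finite S"
  shows "(\<Sum>x\<in>S. h (orbit q x)) = (\<Sum>C\<in>orbit q ` S. of_nat (card C) * h C)"
proof -
  have "(\<Sum>x\<in>S. h (orbit q x))
      = (\<Sum>C\<in>orbit q ` S. \<Sum>x\<in>{x. x \<in> S \<and> orbit q x = C}. h (orbit q x))"
    by (rule sum.image_gen[OF S])
  also have "\<dots> = (\<Sum>C\<in>orbit q ` S. of_nat (card C) * h C)"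
  proof (rule sum.cong[OF refl])
    fix C assume C: "C \<in> orbit q ` S"
    have "{x. x \<in> S \<and> orbit q x = C} = C"
      using C permutes_orbit_subset[OF q] orbit_eq_of_mem[OF q S] self_in_orbit[OF q S] by auto
    moreover have "(\<Sum>x\<in>{x. x \<in> S \<and> orbit q x = C}. h (orbit q x))
        = (\<Sum>x\<in>{x. x \<in> S \<and> orbit q x = C}. h C)"
      by (rule sum.cong) auto
    ultimately show "(\<Sum>x\<in>{x. x \<in> S \<and> orbit q x = C}. h (orbit q x)) = of_nat (card C) * h C"
      by simp
  qed
  finally show ?thesis .
qed

subsection \<open>Higher derivatives of a composition\<close>

lemma fps_deriv_prod:
  fixes f :: "'i \<Rightarrow> 'a :: comm_ring_1 fps"
  assumes "finite A"
  shows "fps_deriv (\<Prod>i\<in>A. f i) = (\<Sum>i\<in>A. fps_deriv (f i) * (\<Prod>j\<in>A - {i}. f j))"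
  using assms
proof (induction A rule: finite_induct)
  case (insert k A)
  have "(\<Sum>i\<in>A. fps_deriv (f i) * (\<Prod>j\<in>insert k A - {i}. f j))
      = (\<Sum>i\<in>A. f k * (fps_deriv (f i) * (\<Prod>j\<in>A - {i}. f j)))"
  proof (rule sum.cong[OF refl])
    fix i assume "i \<in> A"
    then have "insert k A - {i} = insert k (A - {i})"
      using insert.hyps by auto
    then show "fps_deriv (f i) * (\<Prod>j\<in>insert k A - {i}. f j)
        = f k * (fps_deriv (f i) * (\<Prod>j\<in>A - {i}. f j))"
      using insert.hyps by (simp add: mult_ac)
  qed
  then show ?case
    using insert by (simp add: sum_distrib_left add_ac)
qed simp

text \<open>Faa di Bruno's formula for \<open>g 0 = G \<circ> L\<close>, where \<open>g m\<close> stands for the \<open>m\<close>-th derivative of \<open>G\<close>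
  composed with \<open>L\<close>, and \<open>b m\<close> for the \<open>m\<close>-th derivative of \<open>L\<close> divided by \<open>(m - 1)!\<close>. A set
  partition is counted once for every choice of a cyclic order on each block, which these
  factorials compensate.\<close>

lemma fps_deriv_funpow_permutations:
  fixes g b :: "nat \<Rightarrow> 'a :: comm_ring_1 fps"
  assumes S: "finite S"
    and g: "\<And>m. fps_deriv (g m) = g (Suc m) * b 1"
    and b: "\<And>m. fps_deriv (b m) = of_nat m * b (Suc m)"
  shows "(fps_deriv ^^ card S) (g 0)
    = (\<Sum>w\<in>{w. w permutes S}. g (card (orbit w ` S)) * (\<Prod>C\<in>orbit w ` S. b (card C)))"
  using S
proof (induction S rule: finite_induct)
  case empty
  then show ?case by (simp add: permutes_empty)
next
  case (insert a S)
  define F where "F w T = g (card (orbit w ` T)) * (\<Prod>C\<in>orbit w ` T. b (card C))"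
    for w :: "'b \<Rightarrow> 'b" and T
  \<comment> \<open>The product rule matches the choice of \<open>c\<close>: for
    \<open>c = a\<close> the new point is fixed and the derivative hits \<open>g\<close>; for
    \<open>c\<close> in \<open>S\<close> it joins the cycle of \<open>c\<close> and the derivative
    hits the factor of that cycle, giving \<open>h\<close>.\<close>
  have step: "fps_deriv (F q S) = (\<Sum>c\<in>insert a S. F (transpose a c \<circ> q) (insert a S))"
    if q: "q permutes S" for q
  proof -
    let ?O = "orbit q ` S"
    define h where "h C = g (card ?O) * (b (Suc (card C)) * (\<Prod>D\<in>?O - {C}. b (card D)))" for C
    have "F q (insert a S) = g (Suc (card ?O)) * b 1 * (\<Prod>C\<in>?O. b (card C))"
      unfolding F_def orbits_insert_fixed(1)[OF q insert.hyps(2)]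
      using orbits_insert_fixed(2)[OF q insert.hyps(2)] insert.hyps(1) by (simp add: mult_ac)
    moreover have "F (transpose a c \<circ> q) (insert a S) = h (orbit q c)" if c: "c \<in> S" for c
    proof -
      have a: "a \<notin> orbit q c"
        using permutes_orbit_subset[OF q c] insert.hyps by auto
      have fin: "finite (orbit q c)"
        using finite_subset[OF permutes_orbit_subset[OF q c] insert.hyps(1)] .
      have card: "Suc (card (?O - {orbit q c})) = card ?O"
        using c insert.hyps by (intro card.remove[symmetric]) auto
      note * = orbits_transpose_comp[OF q insert.hyps c]
      show ?thesis
        unfolding F_def *(1) h_def
        using *(2) insert.hyps(1) a fin card by simp
    qed
    ultimately have "(\<Sum>c\<in>insert a S. F (transpose a c \<circ> q) (insert a S))
        = g (Suc (card ?O)) * b 1 * (\<Prod>C\<in>?O. b (card C)) + (\<Sum>c\<in>S. h (orbit q c))"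
      using insert.hyps by simp
    also have "(\<Sum>c\<in>S. h (orbit q c)) = (\<Sum>C\<in>?O. of_nat (card C) * h C)"
      by (rule sum_over_orbits[OF q insert.hyps(1)])
    also have "\<dots> = g (card ?O) * fps_deriv (\<Prod>C\<in>?O. b (card C))"
      using insert.hyps by (simp add: fps_deriv_prod b h_def sum_distrib_left mult_ac)
    also have "g (Suc (card ?O)) * b 1 * (\<Prod>C\<in>?O. b (card C))
        + g (card ?O) * fps_deriv (\<Prod>C\<in>?O. b (card C)) = fps_deriv (F q S)"
      by (simp add: F_def g add_ac)
    finally show ?thesis ..
  qed
  have "(fps_deriv ^^ card (insert a S)) (g 0) = fps_deriv (\<Sum>w\<in>{w. w permutes S}. F w S)"
    using insert by (simp add: F_def)
  also have "\<dots> = (\<Sum>q\<in>{w. w permutes S}. \<Sum>c\<in>insert a S. F (transpose a c \<circ> q) (insert a S))"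
    by (simp add: fps_deriv_sum step)
  also have "\<dots> = (\<Sum>w\<in>{w. w permutes insert a S}. F w (insert a S))"
    unfolding sum_over_permutations_insert[OF insert.hyps] by (rule sum.swap)
  finally show ?case
    by (simp add: F_def)
qed

subsection \<open>Inserting the largest value into a permutation\<close>

text \<open>\<open>w \<circ> insert_pos n p\<close> is the word of \<open>w\<close> with the letter \<open>n + 1\<close> inserted at position \<open>p\<close>.\<close>

definition insert_pos :: "nat \<Rightarrow> nat \<Rightarrow> nat \<Rightarrow> nat" where
  "insert_pos n p i = (if i = p then Suc n else if p < i \<and> i \<le> Suc n then i - 1 else i)"

lemma insert_pos_permutes:
  assumes p: "p \<in> {1..Suc n}"
  shows "insert_pos n p permutes {1..Suc n}"
proof (rule bij_imp_permutes)
  have inj: "inj_on (insert_pos n p) {1..Suc n}"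
    using p by (auto simp: inj_on_def insert_pos_def split: if_splits)
  have "insert_pos n p ` {1..Suc n} \<subseteq> {1..Suc n}"
    using p by (auto simp: insert_pos_def split: if_splits)
  then have "insert_pos n p ` {1..Suc n} = {1..Suc n}"
    using inj by (intro endo_inj_surj) auto
  with inj show "bij_betw (insert_pos n p) {1..Suc n} {1..Suc n}"
    by (simp add: bij_betw_def)
  show "insert_pos n p x = x" if "x \<notin> {1..Suc n}" for x
    using that p by (auto simp: insert_pos_def)
qed

text \<open>The position of the letter \<open>Suc n\<close> recovers \<open>p\<close>, which gives
  injectivity; surjectivity follows by counting, as (n+1) n! = (n+1)!.\<close>

lemma bij_betw_insert_pos:
  "bij_betw (\<lambda>(w, p). w \<circ> insert_pos n p) ({w. w permutes {1..n}} \<times> {1..Suc n})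
    {w. w permutes {1..Suc n}}"
proof -
  let ?f = "\<lambda>(w, p). w \<circ> insert_pos n p" and ?A = "{w. w permutes {1..n}} \<times> {1..Suc n}"
  have inj: "inj_on ?f ?A"
  proof (rule inj_onI, clarify)
    fix v p w r
    assume v: "v permutes {1..n}" and w: "w permutes {1..n}"
      and p: "p \<in> {1..Suc n}" and r: "r \<in> {1..Suc n}"
      and eq: "v \<circ> insert_pos n p = w \<circ> insert_pos n r"
    have "(v \<circ> insert_pos n p) p = Suc n"
      using permutes_not_in[OF v, of "Suc n"] by (simp add: insert_pos_def)
    then have "w (insert_pos n r p) = w (Suc n)"
      using eq permutes_not_in[OF w, of "Suc n"] by simp
    then have "insert_pos n r p = Suc n"
      using permutes_inj[OF w] by (simp add: inj_eq)
    then have pr: "p = r"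
      using p r by (auto simp: insert_pos_def split: if_splits)
    have "v = w"
      using eq permutes_surj[OF insert_pos_permutes[OF p]] unfolding pr
      by (metis surj_fun_eq fun.set_map comp_apply)
    with pr show "v = w \<and> p = r" by simp
  qed
  have "?f ` ?A \<subseteq> {w. w permutes {1..Suc n}}"
  proof clarify
    fix w p assume "w permutes {1..n}" "p \<in> {1..Suc n}"
    then show "(w \<circ> insert_pos n p) permutes {1..Suc n}"
      using permutes_compose[OF insert_pos_permutes permutes_subset] by auto
  qed
  moreover have "card (?f ` ?A) = card {w. w permutes {1..Suc n}}"
    using inj by (simp add: card_image card_cartesian_product card_permutations)
  ultimately have "?f ` ?A = {w. w permutes {1..Suc n}}"
    by (intro card_subset_eq) (auto simp: finite_permutations)
  with inj show ?thesis by (simp add: bij_betw_def)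
qed

lemma des_le: "des n w \<le> n"
proof -
  have "des n w \<le> card {1..<n}"
    unfolding des_def by (rule card_mono) auto
  then show ?thesis by simp
qed

text \<open>A largest letter placed at the end, or between the two letters of a descent, keeps the
  number of descents. In any other slot it is followed by a smaller letter and destroys no
  descent.\<close>

lemma des_insert_pos:
  assumes w: "w permutes {1..n}" and p: "p \<in> {1..Suc n}"
  defines "D \<equiv> {i. 1 \<le> i \<and> i < n \<and> w i > w (i + 1)}"
  shows "des (Suc n) (w \<circ> insert_pos n p)
    = (if p \<in> insert (Suc n) (Suc ` D) then des n w else Suc (des n w))"
proof -
  let ?v = "w \<circ> insert_pos n p"
  have wn: "w (Suc n) = Suc n"
    using permutes_not_in[OF w] by simp
  have wle: "w i < Suc n" if "1 \<le> i" "i \<le> n" for i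
    using permutes_in_image[OF w, of i] that by simp
  have D: "D \<subseteq> {1..<n}"
    by (auto simp: D_def)
  show ?thesis
  proof (cases "p = Suc n")
    case True
    have "{i. 1 \<le> i \<and> i < Suc n \<and> ?v i > ?v (i + 1)} = D"
      using wle[of n] wn True by (auto simp: D_def insert_pos_def less_Suc_eq)
    then show ?thesis
      using True by (simp add: des_def D_def)
  next
    case False
    then have pn: "p \<le> n" "1 \<le> p" using p by auto
    \<comment> \<open>Descents from position \<open>p\<close> on move one place right. The pair at
      \<open>p - 1\<close> is broken up by the new letter, which itself starts a descent at
      \<open>p\<close>.\<close>
    define \<phi> where "\<phi> i = (if i < p then i else Suc i)" for i
    have "{i. 1 \<le> i \<and> i < Suc n \<and> ?v i > ?v (i + 1)} = insert p (\<phi> ` (D - {p - 1}))"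
    proof (rule set_eqI)
      fix i
      consider "i + 1 < p" | "i + 1 = p" | "i = p" | j where "i = Suc j" "p \<le> j"
        by (metis Suc_eq_plus1 Suc_leI less_Suc_eq less_imp_Suc_add linorder_neqE_nat
            le_add1 le_eq_less_or_eq not_less_eq)
      then show "i \<in> {i. 1 \<le> i \<and> i < Suc n \<and> ?v i > ?v (i + 1)} \<longleftrightarrow> i \<in> insert p (\<phi> ` (D - {p - 1}))"
      proof cases
        case 1
        then show ?thesis using pn by (auto simp: insert_pos_def \<phi>_def D_def image_iff)
      next
        case 2
        then show ?thesis using pn wn wle[of i] by (auto simp: insert_pos_def \<phi>_def D_def image_iff)
      next
        case 3
        then show ?thesis using pn wn wle[of i] by (auto simp: insert_pos_def)
      next
        case 4
        then show ?thesis using pn by (auto simp: insert_pos_def \<phi>_def D_def image_iff)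
      qed
    qed
    moreover have "inj_on \<phi> (D - {p - 1})"
      by (auto simp: inj_on_def \<phi>_def split: if_splits)
    moreover have "p \<notin> \<phi> ` (D - {p - 1})"
      by (auto simp: \<phi>_def split: if_splits)
    moreover have "finite D"
      using D finite_subset by blast
    ultimately have "des (Suc n) ?v = Suc (card (D - {p - 1}))"
      by (simp add: des_def card_image)
    moreover have "p \<in> insert (Suc n) (Suc ` D) \<longleftrightarrow> p - 1 \<in> D"
      using pn by (auto simp: image_iff intro: bexI[of _ "p - 1"])
    moreover have "des n w = card D"
      by (simp add: des_def D_def)
    moreover have "Suc (card (D - {p - 1})) = card D" if "p - 1 \<in> D"
      using card.remove[OF \<open>finite D\<close> that] by simp
    ultimately show ?thesis
      by (auto simp: card_Diff_singleton_if)
  qed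
qed

text \<open>Of the n+1 slots, \<open>Suc (des n w)\<close> keep the descent number and the others
  raise it by one. The weight \<open>f\<close> is arbitrary so that it can later be a monomial in
  the series \<open>x\<close>, \<open>a\<close>, \<open>b\<close>.\<close>

lemma sum_des_Suc:
  fixes f :: "nat \<Rightarrow> 'a :: comm_semiring_1"
  shows "(\<Sum>w\<in>{w. w permutes {1..Suc n}}. f (des (Suc n) w))
    = (\<Sum>w\<in>{w. w permutes {1..n}}.
        of_nat (Suc (des n w)) * f (des n w) + of_nat (n - des n w) * f (Suc (des n w)))"
proof -
  have "(\<Sum>w\<in>{w. w permutes {1..Suc n}}. f (des (Suc n) w))
      = (\<Sum>(w, p)\<in>{w. w permutes {1..n}} \<times> {1..Suc n}. f (des (Suc n) (w \<circ> insert_pos n p)))"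
    by (subst sum.reindex_bij_betw[OF bij_betw_insert_pos, symmetric]) (simp add: case_prod_unfold)
  also have "\<dots> = (\<Sum>w\<in>{w. w permutes {1..n}}. \<Sum>p\<in>{1..Suc n}. f (des (Suc n) (w \<circ> insert_pos n p)))"
    by (rule sum.cartesian_product[symmetric])
  also have "\<dots> = (\<Sum>w\<in>{w. w permutes {1..n}}.
        of_nat (Suc (des n w)) * f (des n w) + of_nat (n - des n w) * f (Suc (des n w)))"
  proof (rule sum.cong[OF refl])
    fix w assume "w \<in> {w. w permutes {1..n}}"
    then have w: "w permutes {1..n}" by simp
    define D where "D = {i. 1 \<le> i \<and> i < n \<and> w i > w (i + 1)}"
    define E where "E = insert (Suc n) (Suc ` D)"
    have fin: "finite D" "E \<subseteq> {1..Suc n}"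
      by (auto simp: D_def E_def)
    have "card E = Suc (des n w)"
      unfolding E_def using fin by (subst card_insert_disjoint) (auto simp: D_def des_def card_image)
    moreover from this have "card ({1..Suc n} - E) = n - des n w"
      using fin by (subst card_Diff_subset) (auto intro: finite_subset)
    moreover have "(\<Sum>p\<in>{1..Suc n}. f (des (Suc n) (w \<circ> insert_pos n p)))
        = (\<Sum>p\<in>{1..Suc n}. if p \<in> E then f (des n w) else f (Suc (des n w)))"
      using des_insert_pos[OF w] by (intro sum.cong) (auto simp: E_def D_def)
    moreover have "\<dots> = (\<Sum>p\<in>E. f (des n w)) + (\<Sum>p\<in>{1..Suc n} - E. f (Suc (des n w)))"
      using fin by (subst sum.If_cases) (auto simp: Int_absorb1 Diff_eq)
    ultimately show "(\<Sum>p\<in>{1..Suc n}. f (des (Suc n) (w \<circ> insert_pos n p)))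
        = of_nat (Suc (des n w)) * f (des n w) + of_nat (n - des n w) * f (Suc (des n w))"
      by simp
  qed
  finally show ?thesis .
qed

subsection \<open>Generating functions of the Narayana polynomials\<close>

lemma coeff_narayana_poly:
  "coeff (narayana_poly n) k = of_nat (n choose k) * of_nat (n choose Suc k) / of_nat n"
  by (simp add: narayana_poly_def coeff_sum coeff_monom sum.delta' binomial_eq_0)

lemma coeff_narayana_B_poly_Suc:
  "coeff (narayana_B_poly (Suc n)) k = (of_nat (n choose k))\<^sup>2"
  by (simp add: narayana_B_poly_def coeff_sum coeff_monom sum.delta' binomial_eq_0)

text \<open>Absorption makes \<open>n * b\<close> a multiple of either \<open>e\<close> or
  \<open>f\<close>, \<open>n * d\<close> one of \<open>e\<close> and \<open>n * a\<close> one of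
  \<open>f\<close>. What remains is (n-j)(j+1) - (n-j-1)j = n.\<close>

lemma binomial_square_minus_neighbours:
  defines "c \<equiv> \<lambda>m k. rat_of_nat (m choose k)"
  shows "of_nat (Suc m) * (c m (Suc k) ^ 2 - c m (Suc (Suc k)) * c m k)
    = c (Suc m) (Suc k) * c (Suc m) (Suc (Suc k))"
proof -
  define a b d e f where "a = c m (Suc (Suc k))" and "b = c m (Suc k)" and "d = c m k"
    and "e = c (Suc m) (Suc k)" and "f = c (Suc m) (Suc (Suc k))"
  define n j where "n = rat_of_nat (Suc m)" and "j = rat_of_nat (Suc k)"
  have e: "e = b + d" and f: "f = a + b"
    by (simp_all add: a_def b_def d_def e_def f_def c_def)
  have 1: "j * e = n * d"
    unfolding j_def e_def n_def d_def c_def of_nat_mult[symmetric]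
    by (simp only: Suc_times_binomial)
  have 2: "(j + 1) * f = n * b"
  proof -
    have "(j + 1) * f = rat_of_nat (Suc (Suc k) * (Suc m choose Suc (Suc k)))"
      by (simp only: j_def f_def c_def of_nat_mult of_nat_Suc) (simp add: algebra_simps)
    also have "\<dots> = n * b"
      by (simp only: Suc_times_binomial n_def b_def c_def of_nat_mult)
    finally show ?thesis .
  qed
  have 3: "n * b = (n - j) * e"
    using 1 e by (simp add: algebra_simps)
  have 4: "n * a = (n - (j + 1)) * f"
    using 2 f by (simp add: algebra_simps)
  have "n * (n * (b\<^sup>2 - a * d)) = (n * b) * (n * b) - (n * a) * (n * d)"
    by (simp add: algebra_simps power2_eq_square)
  also have "(n * b) * (n * b) = (n - j) * e * ((j + 1) * f)"
    using 2 3 by simp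
  also have "(n * a) * (n * d) = (n - (j + 1)) * f * (j * e)"
    using 1 4 by simp
  finally have "n * (n * (b\<^sup>2 - a * d)) = n * (e * f)"
    by (simp add: algebra_simps)
  then have "n * (b\<^sup>2 - a * d) = e * f"
    by (simp add: n_def)
  then show ?thesis
    by (simp add: a_def b_def d_def e_def f_def n_def)
qed

text \<open>Squaring Pascal's rule leaves the cross term 2 C(m,k) C(m,k-1), a Narayana coefficient
  times 2m.\<close>

lemma narayana_B_poly_rec1:
  "narayana_B_poly (Suc (Suc m)) - (1 + [:0, 1:]) * narayana_B_poly (Suc m)
    = 2 * of_nat m * [:0, 1:] * narayana_poly m"
proof -
  have "narayana_B_poly (Suc (Suc m)) - (narayana_B_poly (Suc m) + pCons 0 (narayana_B_poly (Suc m)))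
      = pCons 0 (smult (2 * of_nat m) (narayana_poly m))"
    by (rule poly_eqI)
      (auto simp: coeff_pCons coeff_narayana_poly coeff_narayana_B_poly_Suc power2_eq_square
        algebra_simps split: nat.split)
  then show ?thesis
    by (simp add: algebra_simps of_nat_poly numeral_poly)
qed

text \<open>After Pascal's rule the coefficients on the left collapse to -2 (b^2 - a d) for three
  neighbouring binomials a, b, d of row \<open>m\<close>, which
  \<open>binomial_square_minus_neighbours\<close> evaluates.\<close>

lemma narayana_B_poly_rec2:
  "narayana_B_poly (Suc (Suc (Suc m))) - 2 * (1 + [:0, 1:]) * narayana_B_poly (Suc (Suc m))
      + (1 - [:0, 1:])\<^sup>2 * narayana_B_poly (Suc m)
    = - (2 * [:0, 1:] * narayana_poly (Suc m))"
proof -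
  let ?B = "\<lambda>m. narayana_B_poly (Suc m)"
  have "?B (Suc (Suc m)) - smult 2 (?B (Suc m) + pCons 0 (?B (Suc m)))
      + (?B m - smult 2 (pCons 0 (?B m)) + pCons 0 (pCons 0 (?B m)))
    = pCons 0 (smult (- 2) (narayana_poly (Suc m)))"
  proof (rule poly_eqI)
    fix k
    consider "k = 0" | "k = 1" | j where "k = Suc (Suc j)"
      by (metis One_nat_def not0_implies_Suc)
    then show "coeff (?B (Suc (Suc m)) - smult 2 (?B (Suc m) + pCons 0 (?B (Suc m)))
          + (?B m - smult 2 (pCons 0 (?B m)) + pCons 0 (pCons 0 (?B m)))) k
        = coeff (pCons 0 (smult (- 2) (narayana_poly (Suc m)))) k"
    proof cases
      case 1
      then show ?thesis by (simp add: coeff_narayana_B_poly_Suc)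
    next
      case 2
      then show ?thesis
        by (simp add: coeff_narayana_B_poly_Suc coeff_narayana_poly power2_eq_square field_simps)
    next
      case 3
      define n where "n = 1 + rat_of_nat m"
      have "n \<noteq> 0" by (simp add: n_def add_nonneg_eq_0_iff)
      with binomial_square_minus_neighbours[of m j] show ?thesis
        unfolding 3
        by (simp add: coeff_narayana_B_poly_Suc coeff_narayana_poly flip: n_def)
          (simp add: power2_eq_square field_simps)
    qed
  qed
  moreover define X where "X = [:0, 1 :: rat:]"
  have "pCons 0 p = X * p" "smult 2 p = 2 * p" "smult (- 2) p = - 2 * p" for p
    by (simp_all add: X_def numeral_poly)
  ultimately have "?B (Suc (Suc m)) - 2 * (?B (Suc m) + X * ?B (Suc m))
      + (?B m - 2 * (X * ?B m) + X * (X * ?B m)) = X * (- 2 * narayana_poly (Suc m))"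
    by (simp only:)
  then show ?thesis
    unfolding X_def[symmetric] by (simp add: algebra_simps power2_eq_square)
qed

section \<open>From the recurrences to the quadratic and differential equations\<close>

definition narayana_fps :: "rat poly fps" where
  "narayana_fps = Abs_fps narayana_poly"

text \<open>The shifted index makes this the \<open>z\<close>-derivative of the series L with
  coefficients B_n / n.\<close>

definition narayana_B_fps :: "rat poly fps" where
  "narayana_B_fps = Abs_fps (\<lambda>m. narayana_B_poly (Suc m))"

text \<open>The two recurrences become the linear relations \<open>E1\<close> and \<open>E2\<close>.
  They force \<open>\<Delta> * R\<^sup>2 = 1\<close>, hence the quadratic equation for
  \<open>N\<close>, whose implicit differentiation gives the claim.\<close>

lemma narayana_fps_deriv:
  includes fps_syntax
  defines "x \<equiv> fps_const [:0, 1 :: rat:]"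
  shows "fps_deriv narayana_fps = (1 + narayana_fps) * (1 + x * narayana_fps) * narayana_B_fps"
proof -
  define z :: "rat poly fps" where "z = fps_X"
  define N where "N = narayana_fps"
  define R where "R = narayana_B_fps"
  define N' where "N' = fps_deriv N"
  define R' where "R' = fps_deriv R"
  \<comment> \<open>The discriminant of N = z (1 + N) (1 + x N) as a quadratic in N, equal to (1 -
    (1+x) z)^2 - 4 x z^2.\<close>
  define \<Delta> where "\<Delta> = 1 - 2 * (1 + x) * z + (1 - x)\<^sup>2 * z\<^sup>2"
  have z: "z \<noteq> 0" and x: "x \<noteq> 0" by (simp_all add: z_def x_def)
  have B1: "narayana_B_poly (Suc 0) = 1"
    by (simp add: narayana_B_poly_def monom_0)
  have N0: "narayana_poly 0 = 0"
    by (simp add: narayana_poly_def)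
  have [simp]: "fps_deriv x = 0" "fps_deriv z = 1"
    by (simp_all add: x_def z_def)
  have cst: "1 + x = fps_const (1 + [:0, 1:])" "2 * (1 + x) = fps_const (2 * (1 + [:0, 1:]))"
      "(1 - x)\<^sup>2 = fps_const ((1 - [:0, 1:])\<^sup>2)" "2 * x = fps_const (2 * [:0, 1:])"
    unfolding x_def
    by (simp_all only: fps_const_1_eq_1[symmetric] numeral_fps_const fps_const_add
        fps_const_sub fps_const_mult fps_const_power)
  have E1: "(1 - (1 + x) * z) * R - 1 = 2 * x * (z * (z * N'))"
  proof -
    have "(R - (1 + x) * (z * R) - 1) $ n = (2 * x * (z * (z * N'))) $ n" for n
    proof (cases n)
      case 0
      then show ?thesis by (simp add: cst z_def R_def narayana_B_fps_def B1)
    next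
      case (Suc m)
      have "(z * N') $ m = of_nat m * narayana_poly m"
        by (cases m) (simp_all add: z_def N'_def N_def narayana_fps_def)
      then have "(2 * x * (z * (z * N'))) $ n = 2 * [:0, 1:] * (of_nat m * narayana_poly m)"
        using Suc by (simp add: cst z_def del: mult_pCons_left mult_pCons_right)
      then show ?thesis
        using narayana_B_poly_rec1[of m] Suc
        by (simp add: cst z_def R_def narayana_B_fps_def mult_ac del: mult_pCons_left mult_pCons_right)
    qed
    then have "R - (1 + x) * (z * R) - 1 = 2 * x * (z * (z * N'))"
      by (rule fps_ext)
    then show ?thesis
      by (simp add: algebra_simps)
  qed
  have E2: "\<Delta> * R = 1 - (1 + x) * z - 2 * x * (z * N)"
  proof -
    have "(R - 2 * (1 + x) * (z * R) + (1 - x)\<^sup>2 * (z * (z * R))) $ n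
        = (1 - (1 + x) * z - 2 * x * (z * N)) $ n" for n
    proof -
      consider "n = 0" | "n = 1" | m where "n = Suc (Suc m)"
        by (metis One_nat_def not0_implies_Suc)
      then show ?thesis
      proof cases
        case 1
        then show ?thesis by (simp add: cst z_def R_def narayana_B_fps_def B1)
      next
        case 2
        then show ?thesis
          using narayana_B_poly_rec1[of 0]
          by (simp add: cst z_def R_def N_def narayana_B_fps_def narayana_fps_def B1 N0
              one_pCons numeral_poly algebra_simps)
      next
        case 3
        then show ?thesis
          using narayana_B_poly_rec2[of m] unfolding cst(2-4)
          by (simp add: cst(1) z_def R_def N_def narayana_B_fps_def narayana_fps_def del: mult_pCons_left)
      qed
    qed
    then have "R - 2 * (1 + x) * (z * R) + (1 - x)\<^sup>2 * (z * (z * R))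
        = 1 - (1 + x) * z - 2 * x * (z * N)"
      by (rule fps_ext)
    then show ?thesis
      by (simp add: \<Delta>_def algebra_simps power2_eq_square)
  qed
  have "fps_deriv (\<Delta> * R) = fps_deriv (1 - (1 + x) * z - 2 * x * (z * N))"
    by (simp only: E2)
  moreover have "fps_deriv (1 - (1 + x) * z - 2 * x * (z * N)) = - (1 + x) - 2 * x * (N + z * N')"
    by (simp add: N'_def algebra_simps)
  moreover have "fps_deriv \<Delta> = - 2 * (1 + x) + 2 * (1 - x)\<^sup>2 * z"
    by (simp add: \<Delta>_def power2_eq_square algebra_simps)
  ultimately have E3: "\<Delta> * R' + (- 2 * (1 + x) + 2 * (1 - x)\<^sup>2 * z) * R = - (1 + x) - 2 * x * (N + z * N')"
    by (simp add: R'_def)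
  \<comment> \<open>\<open>E1\<close> and \<open>E2\<close> combine to the differential equation of \<open>\<Delta> powr (- 1/2)\<close> for \<open>R\<close>.\<close>
  have "z * fps_deriv (\<Delta> * R\<^sup>2) = z * R * (2 * \<Delta> * R' + (- 2 * (1 + x) + 2 * (1 - x)\<^sup>2 * z) * R)"
    by (simp add: R'_def \<Delta>_def power2_eq_square algebra_simps)
  also have "\<dots> = 0"
  proof -
    \<comment> \<open>The factor \<open>z\<close> turns the terms of \<open>E3\<close> in
      \<open>N\<close> and \<open>N'\<close> into those which \<open>E2\<close> and
      \<open>E1\<close> eliminate.\<close>
    have "z * (\<Delta> * R' + (- 2 * (1 + x) + 2 * (1 - x)\<^sup>2 * z) * R)
        = - (1 + x) * z - 2 * x * (z * N) - 2 * x * (z * (z * N'))"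
      using E3 by algebra
    then have "z * (2 * \<Delta> * R' + (- 2 * (1 + x) + 2 * (1 - x)\<^sup>2 * z) * R) = 0"
      using E1 E2 unfolding \<Delta>_def by algebra
    then show ?thesis by algebra
  qed
  finally have "fps_deriv (\<Delta> * R\<^sup>2) = 0"
    using z by simp
  then have "\<Delta> * R\<^sup>2 = fps_const ((\<Delta> * R\<^sup>2) $ 0)"
    by (simp only: fps_deriv_eq_0_iff)
  also have "(\<Delta> * R\<^sup>2) $ 0 = 1"
    by (simp add: \<Delta>_def R_def narayana_B_fps_def B1 z_def power2_eq_square cst)
  finally have \<Delta>: "\<Delta> * R\<^sup>2 = 1"
    by simp
  \<comment> \<open>By \<open>E2\<close> the left side is the square of \<open>\<Delta> * R\<close>,
    that is \<open>\<Delta>\<close> times \<open>\<Delta> * R\<^sup>2\<close>.\<close>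
  have "(1 - (1 + x) * z - 2 * x * (z * N))\<^sup>2 = \<Delta>"
    unfolding E2[symmetric] using \<Delta> by algebra
  then have "4 * (z * x * N) = 4 * (z * x * (z * (1 + N) * (1 + x * N)))"
    unfolding \<Delta>_def by algebra
  then have N: "N = z * (1 + N) * (1 + x * N)"
    using z x by simp
  have "N' = fps_deriv (z * (1 + N) * (1 + x * N))"
    unfolding N'_def using N by simp
  also have "\<dots> = (1 + N) * (1 + x * N) + z * N' * (1 + x * N) + z * (1 + N) * (x * N')"
    by (simp add: N'_def algebra_simps)
  finally have "N' = (1 + N) * (1 + x * N) + z * N' * (1 + x * N) + z * (1 + N) * (x * N')" .
  \<comment> \<open>Collecting \<open>N'\<close> leaves the factor 1 - (1+x) z - 2 x z N, which is
    \<open>\<Delta> * R\<close> by \<open>E2\<close>.\<close>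
  then have "N' * (\<Delta> * R) = (1 + N) * (1 + x * N)"
    unfolding E2 by (simp add: algebra_simps)
  then have "N' * (\<Delta> * R\<^sup>2) = (1 + N) * (1 + x * N) * R"
    by (simp add: power2_eq_square flip: mult.assoc)
  then show ?thesis
    unfolding \<Delta> by (simp add: N_def N'_def R_def)
qed

subsection \<open>Eulerian polynomials from a derivation\<close>

text \<open>Differentiating \<open>a ^ Suc d * b ^ (m - d)\<close> replaces one \<open>a\<close> by
  \<open>a * b\<close> in d+1 ways, keeping d, or one \<open>b\<close> by \<open>x * a * b\<close>
  in m-d ways, raising d. This is the recursion \<open>sum_des_Suc\<close> for inserting a largest
  letter.\<close>

lemma fps_deriv_eulerian:
  fixes a b x r :: "'a :: comm_ring_1 fps"
  assumes a: "fps_deriv a = a * b * r" and b: "fps_deriv b = x * a * b * r" and x: "fps_deriv x = 0"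
  defines "g \<equiv> \<lambda>m. \<Sum>w\<in>{w. w permutes {1..m}}. x ^ des m w * a ^ Suc (des m w) * b ^ (m - des m w)"
  shows "fps_deriv (g m) = g (Suc m) * r"
proof -
  have b_pow: "fps_deriv (b ^ k) = of_nat k * (x * a * b ^ k * r)" for k
    by (induction k) (simp_all add: b algebra_simps)
  have a_pow: "fps_deriv (a ^ k) = of_nat k * (a ^ k * b * r)" for k
    by (induction k) (simp_all add: a algebra_simps)
  have x_pow: "fps_deriv (x ^ k) = 0" for k
    by (induction k) (simp_all add: x)
  define h where "h d = x ^ d * a ^ Suc d * b ^ (Suc m - d)" for d
  have "fps_deriv (x ^ des m w * a ^ Suc (des m w) * b ^ (m - des m w))
      = (of_nat (Suc (des m w)) * h (des m w) + of_nat (m - des m w) * h (Suc (des m w))) * r" for w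
  proof -
    \<comment> \<open>\<open>des_le\<close> ensures that no truncated subtraction occurs in the
      exponents of \<open>b\<close>.\<close>
    have "Suc m - des m w = Suc (m - des m w)"
      using des_le[of m w] by simp
    then show ?thesis
      unfolding fps_deriv_mult a_pow b_pow x_pow h_def by (simp add: algebra_simps)
  qed
  then have "fps_deriv (g m) = (\<Sum>w\<in>{w. w permutes {1..m}}.
      of_nat (Suc (des m w)) * h (des m w) + of_nat (m - des m w) * h (Suc (des m w))) * r"
    by (simp add: g_def fps_deriv_sum sum_distrib_right)
  also have "\<dots> = (\<Sum>w\<in>{w. w permutes {1..Suc m}}. h (des (Suc m) w)) * r"
    by (simp only: sum_des_Suc)
  finally show ?thesis
    by (simp only: g_def h_def)
qed

section \<open>Conclusion: comparing constant terms in Faa di Bruno's formula\<close>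

theorem corollary5p1:
  fixes n :: nat
  assumes "n \<ge> 1"
  shows "narayana_poly n =
    smult (1 / fact n)
      (\<Sum>w\<in>{w. w permutes {1..n}}. narayana_B_perm n w * eulerian_poly (num_cycles n w))"
proof -
  define x a b where "x = fps_const [:0, 1 :: rat:]" and "a = 1 + narayana_fps"
    and "b = 1 + x * narayana_fps"
  define g where "g m = (\<Sum>w\<in>{w. w permutes {1..m}}.
      x ^ des m w * a ^ Suc (des m w) * b ^ (m - des m w))" for m
  \<comment> \<open>the \<open>m\<close>-th derivative of \<open>\<Sum>n\<ge>1. B\<^sub>n z^n / n\<close> divided by \<open>(m - 1)!\<close>\<close>
  define l where "l m = Abs_fps (\<lambda>j. of_nat (m + j - 1 choose j) * narayana_B_poly (m + j))" for m
  have l1: "l 1 = narayana_B_fps"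
    by (simp add: l_def narayana_B_fps_def)
  have x: "fps_deriv x = 0" by (simp add: x_def)
  have a: "fps_deriv a = a * b * l 1"
    unfolding a_def b_def x_def l1 by (simp add: narayana_fps_deriv)
  then have b: "fps_deriv b = x * a * b * l 1"
    by (simp add: x a_def b_def mult_ac)
  have g: "fps_deriv (g m) = g (Suc m) * l 1" for m
    unfolding g_def by (rule fps_deriv_eulerian[OF a b x])
  \<comment> \<open>The absorption identity for binomials; for \<open>m = 0\<close> both sides
    vanish.\<close>
  have l: "fps_deriv (l m) = of_nat m * l (Suc m)" for m
  proof (rule fps_ext)
    fix j
    have "Suc j * (m + j choose Suc j) = m * (m + j choose j)"
      using Suc_times_binomial_add[of j "m - 1"] by (cases m) (simp_all add: add_ac)
    then have "(of_nat (Suc j * (m + j choose Suc j)) :: rat poly) = of_nat (m * (m + j choose j))"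
      by (simp only:)
    then show "fps_nth (fps_deriv (l m)) j = fps_nth (of_nat m * l (Suc m)) j"
      by (simp add: l_def fps_mult_of_nat_nth mult.assoc[symmetric] del: of_nat_Suc mult_Suc)
  qed
  have N0: "fps_nth narayana_fps 0 = 0"
    by (simp add: narayana_fps_def narayana_poly_def)
  \<comment> \<open>At z = 0 both \<open>a\<close> and \<open>b\<close> become 1, so only the powers
    of \<open>x\<close> survive.\<close>
  have g0: "fps_nth (g m) 0 = eulerian_poly m" for m
    by (simp add: g_def eulerian_poly_def fps_sum_nth fps_nth_power_0 a_def b_def N0 x_def monom_altdef)
  have l0: "fps_nth (l m) 0 = narayana_B_poly m" for m
    by (simp add: l_def)
  have prod0: "fps_nth (\<Prod>C\<in>U. l (card C)) 0 = (\<Prod>C\<in>U. narayana_B_poly (card C))"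
    for U :: "nat set set"
    by (induction U rule: infinite_finite_induct) (simp_all add: l0)
  have "g 0 = a"
    by (simp add: g_def des_def)
  \<comment> \<open>The series \<open>a\<close> and \<open>narayana_fps\<close> differ only in the
    constant term, so their coefficients agree at \<open>n \<ge> 1\<close>.\<close>
  then have "fact n * narayana_poly n = fps_nth ((fps_deriv ^^ card {1..n}) (g 0)) 0"
    using assms by (simp add: fps_0th_higher_deriv a_def narayana_fps_def)
  also have "\<dots> = (\<Sum>w\<in>{w. w permutes {1..n}}. eulerian_poly (card (orbit w ` {1..n}))
      * (\<Prod>C\<in>orbit w ` {1..n}. narayana_B_poly (card C)))"
    by (subst fps_deriv_funpow_permutations[of "{1..n}" g l, OF _ g l]) (simp_all add: fps_sum_nth g0 prod0)
  also have "\<dots> = (\<Sum>w\<in>{w. w permutes {1..n}}. narayana_B_perm n w * eulerian_poly (num_cycles n w))"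
    by (simp add: narayana_B_perm_def num_cycles_def cycle_type_def prod_unfold_prod_mset
        image_mset.compositionality comp_def mult.commute)
  finally have "(\<Sum>w\<in>{w. w permutes {1..n}}. narayana_B_perm n w * eulerian_poly (num_cycles n w))
      = smult (fact n) (narayana_poly n)"
    using of_nat_poly[of "fact n", where 'a = rat] by simp
  then show ?thesis
    by simp
qed

end
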